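(* For any $n\in\mathbb{N}$, the set $\{x^{\sharp n}:x\in\mathbb{R}\}\subseteq\mathbb{R}^n$ is gap-rich.
   Context: $\mathbb{N}=\{1,2,\ldots\}$. For $x\in\mathbb{R}$, $x^{\sharp n}=(x,x,\ldots,x)\in\mathbb{R}^n$ ($n$ copies of $x$). Let $k\in\mathbb{N}$ and let $Y\subseteq\mathbb{R}^k$ be closed without isolated points, with the metric $d$ induced by a norm on $\mathbb{R}^k$. Words over $Y$: $Y^\star=\bigcup_{p\ge1}Y^p$. For $\boldsymbol{x}\in Y^p$, $\boldsymbol{x}^{\sharp\mathbb{Z}}\in Y^{\mathbb{Z}}$ is the $p$-periodic sequence coinciding with $\boldsymbol{x}$ on $\{1,\ldots,p\}$. For words $\boldsymbol{x},\boldsymbol{y}\in Y^\star$ of possibly different lengths, $d(\boldsymbol{x},\boldsymbol{y}):=\sup_{j\in\mathbb{Z}}d\big((\boldsymbol{x}^{\sharp\mathbb{Z}})_j,(\boldsymbol{y}^{\sharp\mathbb{Z}})_j\big)$. For bounded $\boldsymbol{y}=(y_j)_{j\in\mathbb{Z}}\in(\mathbb{R}^k)^{\mathbb{Z}}$ with $y_j=(y_j(1),\ldots,y_j(k))$, define $\boldsymbol{y}^\natural:\mathbb{Z}\to\mathbb{R}$ by $\boldsymbol{y}^\natural(jk+\ell)=y_j(\ell)$, $j\in\mathbb{Z}$, $1\le\ell\le k$, and let $H_{\boldsymbol{y}}$ act on $\ell^2(\mathbb{Z})$ by $[H_{\boldsymbol{y}}\psi](n)=\psi(n-1)+\psi(n+1)+\boldsymbol{y}^\natural(n)\psi(n)$.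 For a word $\boldsymbol{x}\in Y^p$, $H_{\boldsymbol{x}}:=H_{\boldsymbol{x}^{\sharp\mathbb{Z}}}$. $\operatorname{spec}$ denotes the spectrum. $Y$ is gap-rich with exceptional set $S\subseteq\mathbb{R}$ if $S$ is discrete and for every $E\in\mathbb{R}\setminus S$, $\boldsymbol{x}\in Y^\star$ and $\varepsilon>0$ there exists $\boldsymbol{y}\in Y^\star$ with $d(\boldsymbol{x},\boldsymbol{y})<\varepsilon$ and $E\notin\operatorname{spec}(H_{\boldsymbol{y}})$. $Y$ is gap-rich if it is gap-rich with some exceptional set. *)

theory Defs
  imports "HOL-Analysis.Analysis"
begin

text \<open>
  The space of real \<open>k\<close>-vectors is \<^term>\<open>topspace (Euclidean_space k)\<close>: functions \<open>nat \<Rightarrow> real\<close>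
  that vanish at all indices \<open>\<ge> k\<close>. The coordinate \<open>x(l)\<close>, \<open>1 \<le> l \<le> k\<close>, is \<open>x (l - 1)\<close>.
\<close>

definition is_norm :: "nat \<Rightarrow> ((nat \<Rightarrow> real) \<Rightarrow> real) \<Rightarrow> bool" where
  "is_norm k \<nu> \<longleftrightarrow>
     (\<forall>x\<in>topspace (Euclidean_space k). 0 \<le> \<nu> x \<and> (\<nu> x = 0 \<longleftrightarrow> x = (\<lambda>i. 0))) \<and>
     (\<forall>c. \<forall>x\<in>topspace (Euclidean_space k). \<nu> (\<lambda>i. c * x i) = \<bar>c\<bar> * \<nu> x) \<and>
     (\<forall>x\<in>topspace (Euclidean_space k). \<forall>y\<in>topspace (Euclidean_space k).
        \<nu> (\<lambda>i. x i + y i) \<le> \<nu> x + \<nu> y)"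

definition const_vec :: "nat \<Rightarrow> real \<Rightarrow> (nat \<Rightarrow> real)" where
  "const_vec n x = (\<lambda>i. if i < n then x else 0)"

definition words :: "'a set \<Rightarrow> 'a list set" where
  "words Y = lists Y - {[]}"

definition periodize :: "'a list \<Rightarrow> int \<Rightarrow> 'a" where
  "periodize xs j = xs ! nat ((j - 1) mod int (length xs))"

lemma periodize_eq_nth:
  assumes "1 \<le> i" "i \<le> length xs"
  shows "periodize xs (int i) = xs ! (i - 1)"
proof -
  have "int i - 1 = int (i - 1)" using assms by simp
  moreover have "i - 1 < length xs" using assms by simp
  ultimately show ?thesis
    unfolding periodize_def by (simp del: of_nat_diff flip: of_nat_mod)
qed

lemma periodize_periodic: "periodize xs (j + int (length xs)) = periodize xs j"
proof -
  have "j + int (length xs) - 1 = (j - 1) + int (length xs)" by simp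
  then show ?thesis unfolding periodize_def by (metis mod_add_self2)
qed

definition word_dist ::
  "((nat \<Rightarrow> real) \<Rightarrow> real) \<Rightarrow> (nat \<Rightarrow> real) list \<Rightarrow> (nat \<Rightarrow> real) list \<Rightarrow> real" where
  "word_dist \<nu> xs ys = (SUP j. \<nu> (\<lambda>i. periodize xs j i - periodize ys j i))"

definition flatten :: "nat \<Rightarrow> (int \<Rightarrow> nat \<Rightarrow> real) \<Rightarrow> int \<Rightarrow> real" where
  "flatten k y m = y ((m - 1) div int k) (nat ((m - 1) mod int k))"

lemma flatten_eq:
  assumes "1 \<le> l" "l \<le> k"
  shows "flatten k y (j * int k + int l) = y j (l - 1)"
proof -
  have e: "j * int k + int l - 1 = int (l - 1) + j * int k" using assms by simp
  have "l - 1 < k" using assms by simp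
  then have "(j * int k + int l - 1) div int k = j"
    and "(j * int k + int l - 1) mod int k = int (l - 1)"
    unfolding e by (simp_all del: of_nat_diff)
  then show ?thesis unfolding flatten_def by simp
qed

definition ell2 :: "(int \<Rightarrow> complex) set" where
  "ell2 = {\<psi>. (\<lambda>m. (cmod (\<psi> m))\<^sup>2) summable_on UNIV}"

definition ell2_norm :: "(int \<Rightarrow> complex) \<Rightarrow> real" where
  "ell2_norm \<psi> = sqrt (\<Sum>\<^sub>\<infinity>m. (cmod (\<psi> m))\<^sup>2)"

definition bounded_op :: "((int \<Rightarrow> complex) \<Rightarrow> (int \<Rightarrow> complex)) \<Rightarrow> bool" where
  "bounded_op T \<longleftrightarrow>
     (\<forall>\<psi>\<in>ell2. T \<psi> \<in> ell2) \<and>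
     (\<forall>\<phi>\<in>ell2. \<forall>\<psi>\<in>ell2. T (\<lambda>m. \<phi> m + \<psi> m) = (\<lambda>m. T \<phi> m + T \<psi> m)) \<and>
     (\<forall>c. \<forall>\<psi>\<in>ell2. T (\<lambda>m. c * \<psi> m) = (\<lambda>m. c * T \<psi> m)) \<and>
     (\<exists>C. \<forall>\<psi>\<in>ell2. ell2_norm (T \<psi>) \<le> C * ell2_norm \<psi>)"

definition ell2_spec :: "((int \<Rightarrow> complex) \<Rightarrow> (int \<Rightarrow> complex)) \<Rightarrow> complex set" where
  "ell2_spec T = {z. \<not> (\<exists>R. bounded_op R \<and>
     (\<forall>\<psi>\<in>ell2. R (\<lambda>m. T \<psi> m - z * \<psi> m) = \<psi> \<and>
                (\<lambda>m. T (R \<psi>) m - z * R \<psi> m) = \<psi>))}"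

definition schroedinger ::
  "nat \<Rightarrow> (int \<Rightarrow> nat \<Rightarrow> real) \<Rightarrow> (int \<Rightarrow> complex) \<Rightarrow> (int \<Rightarrow> complex)" where
  "schroedinger k y \<psi> =
     (\<lambda>m. \<psi> (m - 1) + \<psi> (m + 1) + complex_of_real (flatten k y m) * \<psi> m)"

text \<open>
  The standing assumptions on \<open>Y\<close> (closed, no isolated points) are part of the definition; the
  norm topology is the topology of \<^term>\<open>Euclidean_space k\<close> for every norm \<open>\<nu>\<close>.
\<close>

definition gap_rich_with ::
  "nat \<Rightarrow> ((nat \<Rightarrow> real) \<Rightarrow> real) \<Rightarrow> (nat \<Rightarrow> real) set \<Rightarrow> real set \<Rightarrow> bool" where
  "gap_rich_with k \<nu> Y S \<longleftrightarrow>
     1 \<le> k \<and>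
     closedin (Euclidean_space k) Y \<and> Y \<subseteq> Euclidean_space k derived_set_of Y \<and>
     discrete S \<and>
     (\<forall>E. E \<notin> S \<longrightarrow> (\<forall>x\<in>words Y. \<forall>\<epsilon>>0. \<exists>y\<in>words Y.
        word_dist \<nu> x y < \<epsilon> \<and>
        complex_of_real E \<notin> ell2_spec (schroedinger k (periodize y))))"

definition gap_rich :: "nat \<Rightarrow> ((nat \<Rightarrow> real) \<Rightarrow> real) \<Rightarrow> (nat \<Rightarrow> real) set \<Rightarrow> bool" where
  "gap_rich k \<nu> Y \<longleftrightarrow> (\<exists>S. gap_rich_with k \<nu> Y S)"

end

theory Submission
  imports Defs "HOL-Computational_Algebra.Polynomial"
begin

text \<open>
  No exceptional set is needed. Let \<open>M(s)\<close> be the monodromy matrix of the word \<open>x - s\<close> at energy \<open>E\<close>;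
  its trace is a polynomial in \<open>s\<close> of degree equal to the period. For generic small \<open>s\<close>, \<open>M(s)\<close> is
  either hyperbolic, and \<open>x - s\<close> has a gap at \<open>E\<close>, or an elliptic matrix with irrational angle.
  In the elliptic case Fricke's polynomial \<open>a\<^sup>2 + b\<^sup>2 + c\<^sup>2 - a b c\<close> in the traces of \<open>M(s)\<close>, \<open>M(t)\<close> and
  \<open>M(s) M(t)\<close> is at least \<open>4\<close>, and, being unbounded in \<open>t\<close>, it exceeds \<open>4\<close> for some small \<open>t\<close>. As the
  angle is irrational, the trace of \<open>M(s)\<^sup>k M(t)\<close> then exceeds \<open>2\<close> in absolute value for some \<open>k\<close>, so that
  the word \<open>x - t\<close> followed by \<open>k\<close> copies of \<open>x - s\<close> is hyperbolic at \<open>E\<close>. Finally, the two Floquet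
  solutions at a hyperbolic energy yield an exponentially decaying Green's function, that is, a
  bounded resolvent.
\<close>

section \<open>Transfer matrices\<close>

text \<open>Acts on column vectors with the newer value on top; \<open>t\<close> will be energy
  minus potential. The ring is arbitrary so that the same matrices can be formed over polynomials in
  a shift of the potential.\<close>

definition step_matrix :: "'a::comm_ring_1 \<Rightarrow> 'a^2^2" where
  "step_matrix t = vector [vector [t, -1], vector [1, 0]]"

primrec transfer :: "(nat \<Rightarrow> 'a::comm_ring_1) \<Rightarrow> nat \<Rightarrow> 'a^2^2" where
  "transfer f 0 = mat 1"
| "transfer f (Suc i) = step_matrix (f i) ** transfer f i"

lemma mat2_mult_nth: "(A ** B) $ i $ j = A$i$1 * B$1$j + A$i$2 * B$2$j"
  for A B :: "'a::semiring_1^2^2"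
  by (simp add: matrix_matrix_mult_def sum_2)

lemma step_matrix_nth [simp]:
  "step_matrix t $ 1 $ 1 = t" "step_matrix t $ 1 $ 2 = -1"
  "step_matrix t $ 2 $ 1 = 1" "step_matrix t $ 2 $ 2 = 0"
  by (simp_all add: step_matrix_def)

lemma trace_mat2: "trace A = A$1$1 + A$2$2" for A :: "'a::semiring_1^2^2"
  by (simp add: trace_def sum_2)

lemma transfer_cong: "(\<And>l. l < i \<Longrightarrow> f l = g l) \<Longrightarrow> transfer f i = transfer g i"
  by (induction i) auto

lemma transfer_add: "transfer f (i + j) = transfer (\<lambda>l. f (i + l)) j ** transfer f i"
  by (induction j) (simp_all add: matrix_mul_assoc)

lemma det_transfer: "det (transfer f i) = 1"
proof (induction i)
  case (Suc i)
  have "det (step_matrix (f i)) = 1" by (simp add: det_2)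
  with Suc show ?case by (simp add: det_mul)
qed simp

lemma transfer_mult_vector:
  fixes w :: "nat \<Rightarrow> 'a::comm_ring_1"
  assumes "\<And>i. w (i + 2) = f i * w (i + 1) - w i"
  shows "transfer f i *v vector [w 1, w 0] = vector [w (i + 1), w i]"
proof (induction i)
  case (Suc i)
  have "step_matrix (f i) *v vector [w (i + 1), w i] = vector [w (i + 2), w (i + 1)]"
    using assms[of i]
    by (simp add: vec_eq_iff forall_2 matrix_vector_mult_def sum_2)
  then show ?case
    using Suc by (simp flip: matrix_vector_mul_assoc)
qed simp

text \<open>Evaluation at \<open>s\<close> is a ring homomorphism, so it commutes with products of
  step matrices. Traces at shifted words thus become polynomials in the shift.\<close>

lemma transfer_shift_poly:
  "transfer (\<lambda>l. f l + s) i $ a $ b = poly (transfer (\<lambda>l. [:f l, 1:]) i $ a $ b) s"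
proof (induction i arbitrary: a b)
  case 0
  then show ?case by (simp add: mat_def)
next
  case (Suc i)
  then show ?case
    using exhaust_2[of a] by (auto simp: mat2_mult_nth)
qed

text \<open>Only the top left entry picks up the linear factor of every step; each other entry
  misses at least one. At \<open>i = 0\<close> the truncated \<open>i - 1\<close> is harmless, as
  all entries are constants.\<close>

lemma degree_transfer_poly:
  fixes f :: "nat \<Rightarrow> 'a::idom"
  defines "P \<equiv> \<lambda>i. transfer (\<lambda>l. [:f l, 1:]) i"
  shows "degree (P i $ 1 $ 1) = i \<and> degree (P i $ 2 $ 1) \<le> i - 1 \<and>
         degree (P i $ 1 $ 2) \<le> i - 1 \<and> degree (P i $ 2 $ 2) \<le> i - 1"
proof (induction i)
  case 0
  show ?case by (simp add: P_def mat_def)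
next
  case (Suc i)
  have d: "degree ([:f i, 1:] * q) \<le> i" if "degree q \<le> i - 1" "i > 0" for q :: "'a poly"
    using degree_mult_le[of "[:f i, 1:]" q] that by simp
  have e: "P (Suc i) $ 1 $ j = [:f i, 1:] * P i $ 1 $ j - P i $ 2 $ j"
    "P (Suc i) $ 2 $ j = P i $ 1 $ j" for j
    by (simp_all add: P_def mat2_mult_nth)
  have nz: "P i $ 1 $ 1 \<noteq> 0"
  proof (cases i)
    case 0 then show ?thesis by (simp add: P_def mat_def)
  next
    case (Suc j) then show ?thesis using Suc.IH by force
  qed
  have 1: "degree (P (Suc i) $ 1 $ 1) = Suc i"
  proof -
    have "degree ([:f i, 1:] * P i $ 1 $ 1) = Suc i"
      using nz Suc by (subst degree_mult_eq) auto
    moreover have "degree (P i $ 2 $ 1) < Suc i"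
      using Suc by auto
    ultimately show ?thesis
      unfolding e by (metis degree_add_eq_left degree_minus diff_conv_add_uminus)
  qed
  have 2: "degree (P (Suc i) $ 1 $ 2) \<le> i"
  proof (cases i)
    case 0
    then show ?thesis unfolding e by (simp add: P_def mat_def)
  next
    case (Suc j)
    show ?thesis unfolding e
      by (intro degree_diff_le d) (use Suc Suc.IH in auto)
  qed
  show ?case using 1 2 Suc unfolding e(2) by auto
qed

lemma degree_trace_transfer_poly:
  fixes f :: "nat \<Rightarrow> 'a::idom"
  shows "degree (trace (transfer (\<lambda>l. [:f l, 1:]) i)) = i"
proof (cases i)
  case 0
  then show ?thesis by (simp add: trace_mat2 mat_def)
next
  case (Suc j)
  then show ?thesis using degree_transfer_poly[of f i] unfolding trace_mat2
    by (subst degree_add_eq_left) auto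
qed

section \<open>Traces of products and the choice of a hyperbolic word\<close>

lemma poly_unbounded:
  fixes p :: "real poly"
  assumes "degree p > 0"
  shows "\<exists>x. \<bar>poly p x\<bar> > C"
proof -
  have "filterlim (\<lambda>x. norm (poly p x)) at_top at_infinity"
    using filterlim_poly_at_infinity[OF assms] by (simp add: filterlim_at_infinity_conv_norm_at_top)
  then have "eventually (\<lambda>x. norm (poly p x) \<ge> C + 1) at_infinity"
    by (simp only: filterlim_at_top)
  then obtain x where "norm (poly p x) \<ge> C + 1"
    using eventually_happens'[OF trivial_limit_at_infinity] by blast
  then show ?thesis by (intro exI[of _ x]) simp
qed

text \<open>By Fricke's identity the polynomial is 2 plus the trace of the commutator of
  \<open>A\<close> and \<open>B\<close>. When \<open>A\<close> is elliptic, its off-diagonal entries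
  have opposite signs, so the excess over 4 may be multiplied by the positive
  \<open>- 4 * (b * c)\<close>, which turns it into a sum of two nonnegative terms.\<close>

lemma fricke_ge:
  fixes A B :: "real^2^2"
  assumes "det A = 1" "det B = 1" "\<bar>trace A\<bar> < 2"
  shows "(trace A)\<^sup>2 + (trace B)\<^sup>2 + (trace (A ** B))\<^sup>2 - trace A * trace B * trace (A ** B) \<ge> 4"
    (is "?F \<ge> 4")
proof -
  define a b c d where "a = A$1$1" "b = A$1$2" "c = A$2$1" "d = A$2$2"
  define p q r s where "p = B$1$1" "q = B$1$2" "r = B$2$1" "s = B$2$2"
  note defs = a_b_c_d_def p_q_r_s_def
  have A: "a * d - b * c = 1" and B: "p * s - q * r = 1"
    using assms by (simp_all add: det_2 defs)
  have F: "?F = (a + d)\<^sup>2 + (p + s)\<^sup>2 + (a * p + b * r + (c * q + d * s))\<^sup>2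
      - (a + d) * (p + s) * (a * p + b * r + (c * q + d * s))"
    by (simp add: trace_mat2 mat2_mult_nth defs)
  have e: "(a + d)\<^sup>2 < 4"
    using assms(3) abs_square_less_1[of "(a + d) / 2"]
    by (simp add: trace_mat2 defs power_divide abs_divide)
  have "4 * (b * c) = (a + d)\<^sup>2 - 4 - (a - d)\<^sup>2"
    using A by algebra
  moreover have "(a - d)\<^sup>2 \<ge> 0" by simp
  ultimately have bc: "b * c < 0" using e by linarith
  \<comment> \<open>Completes the square in \<open>p - s\<close>; the weight
    \<open>4 - (a + d)\<^sup>2\<close> of the other square is positive by ellipticity.\<close>
  have "(- 4 * (b * c)) * (?F - 4) =
      (- 2 * b * c * (p - s) + (a - d) * (b * r + c * q))\<^sup>2 + (4 - (a + d)\<^sup>2) * (b * r - c * q)\<^sup>2"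
    unfolding F using A B by algebra
  also have "\<dots> \<ge> 0"
    using e by (intro add_nonneg_nonneg mult_nonneg_nonneg) auto
  finally have "0 \<le> (- 4 * (b * c)) * (?F - 4)" .
  moreover have "- 4 * (b * c) > 0" using bc by linarith
  ultimately have "0 \<le> ?F - 4" by (simp only: zero_le_mult_iff) linarith
  then show ?thesis by simp
qed

text \<open>Cayley-Hamilton: with determinant 1, the square of \<open>A\<close> is
  \<open>trace A\<close> times \<open>A\<close> minus the identity; multiply by a power of
  \<open>A\<close> times \<open>B\<close> and take traces.\<close>

lemma trace_power_mult_rec:
  fixes A B :: "'a::comm_ring_1^2^2"
  assumes "det A = 1"
  shows "trace (((**) A ^^ (k + 2)) B) =
    trace A * trace (((**) A ^^ (k + 1)) B) - trace (((**) A ^^ k) B)"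
proof -
  have *: "trace (A ** (A ** C)) = trace A * trace (A ** C) - det A * trace C" for C
    by (simp add: trace_mat2 mat2_mult_nth det_2 algebra_simps)
  show ?thesis using *[of "((**) A ^^ k) B"] assms by simp
qed

text \<open>The recurrence is solved by \<rho> cos (k \<theta> - \<phi>), and \<open>amp\<close>
  says that the amplitude \<rho> exceeds 2. Multiples of an irrational angle are dense on the
  circle, so some \<open>k\<close> brings the phase close enough to a multiple of 2 \<pi>.\<close>

lemma oscillation_exceeds_2:
  fixes x :: "nat \<Rightarrow> real"
  assumes rec: "\<And>k. x (k + 2) = 2 * cos \<theta> * x (k + 1) - x k"
    and irr: "\<theta> / pi \<notin> \<rat>" and sin: "sin \<theta> \<noteq> 0"
    and amp: "(x 0)\<^sup>2 + ((x 1 - cos \<theta> * x 0) / sin \<theta>)\<^sup>2 > 4"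
  shows "\<exists>k. \<bar>x k\<bar> > 2"
proof -
  define Q where "Q = (x 1 - cos \<theta> * x 0) / sin \<theta>"
  have x: "x k = x 0 * cos (k * \<theta>) + Q * sin (k * \<theta>)" for k
  proof (induction k rule: induct_nat_012)
    case 1
    then show ?case using sin by (simp add: Q_def)
  next
    case (ge2 k)
    have c: "cos (\<theta> + (\<theta> + real k * \<theta>)) = 2 * cos \<theta> * cos (\<theta> + real k * \<theta>) - cos (real k * \<theta>)"
      "sin (\<theta> + (\<theta> + real k * \<theta>)) = 2 * cos \<theta> * sin (\<theta> + real k * \<theta>) - sin (real k * \<theta>)"
      using sin_cos_squared_add[of \<theta>]
      by (simp_all only: cos_add sin_add) algebra+
    have "x (Suc (Suc k)) = 2 * cos \<theta> * x (Suc k) - x k"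
      using rec[of k] by simp
    also have "\<dots> = x 0 * (2 * cos \<theta> * cos (\<theta> + real k * \<theta>) - cos (real k * \<theta>))
        + Q * (2 * cos \<theta> * sin (\<theta> + real k * \<theta>) - sin (real k * \<theta>))"
      unfolding ge2 by (simp add: algebra_simps)
    finally show ?case unfolding c[symmetric] by (simp add: algebra_simps)
  qed simp
  define \<rho> where "\<rho> = sqrt ((x 0)\<^sup>2 + Q\<^sup>2)"
  have \<rho>: "\<rho> > 2"
    using amp real_sqrt_less_mono[of 4] by (simp add: \<rho>_def Q_def)
  have "(x 0)\<^sup>2 + Q\<^sup>2 = \<rho>\<^sup>2" by (simp add: \<rho>_def)
  then have "(x 0 / \<rho>)\<^sup>2 + (Q / \<rho>)\<^sup>2 = 1"
    using \<rho> unfolding power_divide add_divide_distrib[symmetric] by simp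
  then obtain \<phi> where \<phi>: "x 0 / \<rho> = cos \<phi>" "Q / \<rho> = sin \<phi>"
    using sincos_total_2pi by metis
  have x': "x k = \<rho> * cos (k * \<theta> - \<phi>)" for k
    using \<phi> \<rho> unfolding x[of k] cos_diff by (simp add: field_simps)
  have "isCont (\<lambda>t. \<rho> * cos (2 * pi * t)) 0" by (intro continuous_intros)
  then have "((\<lambda>t. \<rho> * cos (2 * pi * t)) \<longlongrightarrow> \<rho>) (at 0)" unfolding isCont_def by simp
  then have "eventually (\<lambda>t. \<rho> * cos (2 * pi * t) > 2) (at 0)"
    using \<rho> order_tendstoD(1) by blast
  then obtain \<epsilon> where \<epsilon>: "\<epsilon> > 0" "\<And>t. t \<noteq> 0 \<Longrightarrow> \<bar>t\<bar> < \<epsilon> \<Longrightarrow> \<rho> * cos (2 * pi * t) > 2"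
    unfolding eventually_at by (auto simp: dist_real_def)
  have "\<theta> / (2 * pi) \<notin> \<rat>"
  proof
    assume "\<theta> / (2 * pi) \<in> \<rat>"
    then have "2 * (\<theta> / (2 * pi)) \<in> \<rat>" by (intro Rats_mult) auto
    then show False using irr by simp
  qed
  \<comment> \<open>Density modulo 1 of the positive multiples of \<theta> / (2 \<pi>), aimed at
    \<phi> / (2 \<pi>).\<close>
  then obtain h k where k: "k > 0" "\<bar>of_int k * (\<theta> / (2 * pi)) - of_int h - \<phi> / (2 * pi)\<bar> < \<epsilon>"
    using sequence_of_fractional_parts_is_dense \<epsilon>(1) by blast
  define t where "t = of_int k * (\<theta> / (2 * pi)) - of_int h - \<phi> / (2 * pi)"
  have "nat k * \<theta> - \<phi> = 2 * pi * t + 2 * pi * of_int h"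
    using k(1) by (simp add: t_def field_simps)
  then have "cos (nat k * \<theta> - \<phi>) = cos (2 * pi * t)"
    using sin_cos_eq_iff[of "nat k * \<theta> - \<phi>" "2 * pi * t"] by (auto simp: algebra_simps)
  \<comment> \<open>The limit at 0 says nothing about \<open>t = 0\<close> itself, where the cosine
    is 1 and the value is \<rho>.\<close>
  then have "x (nat k) > 2"
    unfolding x' using \<epsilon> k(2) \<rho> by (cases "t = 0") (auto simp: t_def)
  then show ?thesis by (intro exI[of _ "nat k"]) simp
qed

text \<open>Matrices act from the left: the product belongs to one block shifted by
  \<open>s'\<close> followed by \<open>k\<close> blocks shifted by \<open>s\<close>. The bound
  \<delta> keeps the new word close to the old one.\<close>

lemma exists_hyperbolic_shift:
  fixes f :: "nat \<Rightarrow> real"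
  assumes "N > 0" "\<delta> > 0"
  obtains s s' k where "\<bar>s\<bar> < \<delta>" "\<bar>s'\<bar> < \<delta>"
    "\<bar>trace (((**) (transfer (\<lambda>l. f l + s) N) ^^ k) (transfer (\<lambda>l. f l + s') N))\<bar> > 2"
proof -
  define M where "M s = transfer (\<lambda>l. f l + s) N" for s
  define P where "P = transfer (\<lambda>l. [:f l, 1:]) N"
  define p where "p = trace P"
  have deg: "degree p = N" unfolding p_def P_def by (rule degree_trace_transfer_poly)
  have M: "M s $ i $ j = poly (P $ i $ j) s" for s i j
    unfolding M_def P_def by (rule transfer_shift_poly)
  have p: "trace (M s) = poly p s" for s by (simp add: p_def trace_mat2 M)
  \<comment> \<open>Excluded are the shifts whose trace is twice the cosine of a rational multiple
    of \<pi>, among them the parabolic values 2 and -2. Each such equation has finitely many roots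
    as \<open>p\<close> is not constant, so the interval is not exhausted.\<close>
  have "countable (\<Union>q\<in>\<rat>. {s. poly (p - [:2 * cos (pi * q):]) s = 0})"
  proof (intro countable_UN countable_rat)
    fix q :: real
    have "p \<noteq> [:2 * cos (pi * q):]" using deg assms(1) by auto
    then show "countable {s. poly (p - [:2 * cos (pi * q):]) s = 0}"
      by (intro countable_finite poly_roots_finite) simp
  qed
  moreover have "uncountable {-\<delta><..<\<delta>}" using assms(2) by (simp add: uncountable_open_interval)
  ultimately obtain s where s: "s \<in> {-\<delta><..<\<delta>}" "s \<notin> (\<Union>q\<in>\<rat>. {s. poly (p - [:2 * cos (pi * q):]) s = 0})"
    by (metis countable_subset subsetI)
  show thesis
  proof (cases "\<bar>trace (M s)\<bar> > 2")
    case True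
    then show thesis using that[of s s 0] s(1) unfolding M_def by auto
  next
    case False
    define a where "a = trace (M s)"
    define \<theta> where "\<theta> = arccos (a / 2)"
    have cos: "2 * cos \<theta> = a"
      using False unfolding \<theta>_def a_def by (subst cos_arccos) auto
    have irr: "\<theta> / pi \<notin> \<rat>"
      using s(2) cos p[of s] unfolding a_def by auto
    have sin: "sin \<theta> \<noteq> 0"
    proof
      assume "sin \<theta> = 0"
      then obtain i where "\<theta> = of_int i * pi" by (auto simp: sin_zero_iff_int2)
      then show False using irr by simp
    qed
    then have sin2: "(sin \<theta>)\<^sup>2 > 0" by simp
    have a2: "4 - a\<^sup>2 = 4 * (sin \<theta>)\<^sup>2"
      unfolding cos[symmetric] power_mult_distrib by (simp add: sin_squared_eq)
    then have "a\<^sup>2 < 4" using sin2 by linarith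
    then have "\<bar>a / 2\<bar> < 1" by (subst abs_square_less_1[symmetric]) (simp add: power_divide)
    then have a: "\<bar>a\<bar> < 2" by simp
    define q where "q = [:M s $1$1:] * P$1$1 + [:M s $1$2:] * P$2$1 + ([:M s $2$1:] * P$1$2 + [:M s $2$2:] * P$2$2)"
    have q: "trace (M s ** M t) = poly q t" for t
      by (simp add: q_def trace_mat2 mat2_mult_nth M)
    define F where "F = [:a\<^sup>2:] + p\<^sup>2 + q\<^sup>2 - [:a:] * p * q"
    have F: "poly F t = a\<^sup>2 + (trace (M t))\<^sup>2 + (trace (M s ** M t))\<^sup>2 - a * trace (M t) * trace (M s ** M t)" for t
      by (simp add: F_def p q)
    \<comment> \<open>For the sequence of traces starting with \<open>poly p t\<close> and
      \<open>poly q t\<close>, the excess of Fricke's polynomial over 4 is a positive multiple of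
      the excess of the squared amplitude over 4.\<close>
    have F_eq: "poly F t - 4 = (sin \<theta>)\<^sup>2 * ((poly p t)\<^sup>2 + ((poly q t - cos \<theta> * poly p t) / sin \<theta>)\<^sup>2 - 4)" for t
    proof -
      have "(sin \<theta>)\<^sup>2 * ((poly p t)\<^sup>2 + ((poly q t - cos \<theta> * poly p t) / sin \<theta>)\<^sup>2 - 4)
          = (sin \<theta>)\<^sup>2 * ((poly p t)\<^sup>2 - 4) + (poly q t - cos \<theta> * poly p t)\<^sup>2"
        using sin by (simp add: power_divide field_simps)
      also have "\<dots> = poly F t - 4"
        unfolding F p q cos[symmetric] sin_squared_eq by (simp add: power2_eq_square algebra_simps)
      finally show ?thesis ..
    qed
    \<comment> \<open>Otherwise the squared amplitude is 4 for every \<open>t\<close>, which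
      confines \<open>p\<close> to [-2, 2] although its degree is positive.\<close>
    have "\<exists>t. \<bar>t\<bar> < \<delta> \<and> poly F t \<noteq> 4"
    proof (rule ccontr)
      assume "\<not> ?thesis"
      then have "{-\<delta><..<\<delta>} \<subseteq> {t. poly (F - [:4:]) t = 0}" by (auto simp: abs_less_iff)
      moreover have "infinite {-\<delta><..<\<delta>}" using assms(2) by (simp add: infinite_Ioo)
      ultimately have "F - [:4:] = 0" using poly_roots_finite finite_subset by blast
      then have "poly F t = 4" for t by simp
      then have "(poly p t)\<^sup>2 \<le> 2\<^sup>2" for t
        using F_eq[of t] sin2 by (simp add: add_nonneg_eq_0_iff) (smt (verit) zero_le_power2)
      then have "\<bar>poly p t\<bar> \<le> 2" for t
        by (metis abs_le_square_iff abs_numeral)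
      moreover obtain t where "\<bar>poly p t\<bar> > 2"
        using poly_unbounded[of p 2] deg assms(1) by auto
      ultimately show False by (simp add: leD)
    qed
    then obtain t where t: "\<bar>t\<bar> < \<delta>" "poly F t \<noteq> 4" by blast
    have "poly F t \<ge> 4"
      using fricke_ge[of "M s" "M t"] a unfolding F a_def by (simp add: M_def det_transfer)
    then have "(poly p t)\<^sup>2 + ((poly q t - cos \<theta> * poly p t) / sin \<theta>)\<^sup>2 > 4"
      using t(2) F_eq[of t] sin2 by (smt (verit) mult_nonneg_nonpos)
    then have "\<exists>k. \<bar>trace (((**) (M s) ^^ k) (M t))\<bar> > 2"
      using irr sin
      by (intro oscillation_exceeds_2[where \<theta> = \<theta>])
        (simp_all only: trace_power_mult_rec M_def det_transfer cos flip: a_def p q, simp_all add: a_def M_def)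
    then show thesis using that[of s t] s(1) t(1) unfolding M_def by auto
  qed
qed

text \<open>\<open>v\<close> is an eigenvector of the monodromy matrix over the period starting at
  \<open>a + 1\<close>. Forward recursion gives the solution to the right of \<open>a\<close>; the
  multiplier \<mu> then extends it to all integers, instead of running the recursion
  backwards.\<close>

lemma floquet_solution:
  fixes t :: "int \<Rightarrow> real"
  assumes per: "\<And>m. t (m + int N) = t m" and N: "N > 0"
    and ev: "transfer (\<lambda>i. t (a + 1 + int i)) N *v v = \<mu> *s v" and \<mu>: "\<mu> \<noteq> 0"
  obtains u where "\<And>m. u (m - 1) + u (m + 1) = t m * u m"
    "\<And>m. u m = \<mu> powi ((m - a) div int N) * u (a + (m - a) mod int N)"
    "vector [u (a + 1), u a] = v"
proof -
  define f where "f i = t (a + 1 + int i)" for i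
  have f_per: "f (i + N) = f i" for i
    using per[of "a + 1 + int i"] by (simp add: f_def algebra_simps)
  \<comment> \<open>Pairs of consecutive values; the components of \<open>v\<close> enter in reverse
    since vectors carry the newer value first.\<close>
  define w where "w = rec_nat (v$2, v$1) (\<lambda>i (x, y). (y, f i * y - x))"
  define W where "W i = fst (w i)" for i
  have w: "w i = (W i, W (i + 1))" for i
    by (simp add: W_def w_def split: prod.splits)
  have W: "W 0 = v$2" "W 1 = v$1" "W (i + 2) = f i * W (i + 1) - W i" for i
  proof -
    show "W 0 = v$2" "W 1 = v$1" by (simp_all add: W_def w_def)
    have "w (Suc i) = (W (i + 1), f i * W (i + 1) - W i)"
      using w[of i] by (simp add: w_def)
    then show "W (i + 2) = f i * W (i + 1) - W i"
      using w[of "Suc i"] by simp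
  qed
  have v: "vector [W 1, W 0] = v"
    by (simp only: vec_eq_iff forall_2 vector_2 W simp_thms)
  have "vector [W (N + 1), W N] = (\<mu> *s v :: real^2)"
    using transfer_mult_vector[of W f N] W(3) ev v unfolding f_def[abs_def] by simp
  then have WN: "W (N + 1) = \<mu> * W 1" "W N = \<mu> * W 0"
    by (simp_all add: vec_eq_iff forall_2 flip: v)
  have W_per: "W (i + N) = \<mu> * W i" for i
  proof (induction i rule: induct_nat_012)
    case (ge2 i)
    have "W (Suc (Suc i) + N) = f (i + N) * W (Suc i + N) - W (i + N)"
      using W(3)[of "i + N"] by simp
    also have "\<dots> = f i * (\<mu> * W (Suc i)) - \<mu> * W i"
      by (simp only: ge2 f_per)
    also have "\<dots> = \<mu> * W (Suc (Suc i))"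
      using W(3)[of i] by (simp add: right_diff_distrib mult.left_commute)
    finally show ?case .
  qed (use WN in simp_all)
  define u where "u m = \<mu> powi ((m - a) div int N) * W (nat ((m - a) mod int N))" for m
  have W_per': "W (i + r * N) = \<mu> ^ r * W i" for i r
  proof (induction r)
    case (Suc r)
    then show ?case using W_per[of "i + r * N"] by (simp add: algebra_simps)
  qed simp
  \<comment> \<open>The formula for \<open>u\<close> also holds with the number \<open>q\<close> of
    any earlier period. Three neighbouring sites can then be written with one \<open>q\<close>, even
    across the end of a period.\<close>
  have u: "u m = \<mu> powi q * W (nat (m - a - q * int N))" if "q * int N \<le> m - a" for m q
  proof -
    define r where "r = (m - a) div int N - q"
    have "r \<ge> 0" using zdiv_mono1[OF that, of "int N"] N by (simp add: r_def)
    have e: "m - a - q * int N = (m - a) mod int N + r * int N"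
      using div_mult_mod_eq[of "m - a" "int N"] by (simp add: r_def left_diff_distrib)
    have "nat (m - a - q * int N) = nat ((m - a) mod int N) + nat r * N"
      using \<open>r \<ge> 0\<close> N unfolding e by (simp add: nat_add_distrib nat_mult_distrib)
    moreover have "\<mu> powi ((m - a) div int N) = \<mu> powi q * \<mu> ^ nat r"
      using \<mu> \<open>r \<ge> 0\<close> by (simp add: r_def power_int_add[symmetric] flip: power_int_of_nat)
    ultimately show ?thesis by (simp add: u_def W_per')
  qed
  show thesis
  proof
    fix m
    define q where "q = (m - 1 - a) div int N"
    define i where "i = nat (m - 1 - a - q * int N)"
    have le: "q * int N \<le> m - 1 - a"
      using div_mult_mod_eq[of "m - 1 - a" "int N"] pos_mod_sign[of "int N" "m - 1 - a"] N
      unfolding q_def by linarith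
    then have i: "m - 1 - a = int i + q * int N" unfolding i_def by simp
    have t: "t m = f i"
    proof -
      have "t (x + j * int N) = t x" for x j
      proof (induction j rule: int_induct[where k = 0])
        case (step1 j)
        then show ?case using per[of "x + j * int N"] by (simp add: algebra_simps)
      next
        case (step2 j)
        then show ?case using per[of "x + (j - 1) * int N"] by (simp add: algebra_simps)
      qed simp
      from this[of "a + 1 + int i" q] show ?thesis
        using i by (simp add: f_def algebra_simps)
    qed
    have "u (m - 1) = \<mu> powi q * W i" "u m = \<mu> powi q * W (i + 1)" "u (m + 1) = \<mu> powi q * W (i + 2)"
      using u[of q "m - 1"] u[of q m] u[of q "m + 1"] le
        nat_add_distrib[of "int i" 1] nat_add_distrib[of "int i" 2] i
      by (simp_all add: algebra_simps)
    then show "u (m - 1) + u (m + 1) = t m * u m"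
      using W(3)[of i] t by (simp add: right_diff_distrib mult.left_commute)
  next
    fix m
    show "u m = \<mu> powi ((m - a) div int N) * u (a + (m - a) mod int N)"
      using N by (simp add: u_def)
  next
    have "u (a + 1) = W 1" "u a = W 0" using u[of 0 "a + 1"] u[of 0 a] by simp_all
    then show "vector [u (a + 1), u a] = v" using v by simp
  qed
qed

section \<open>Resolvents from Green's functions\<close>

text \<open>Weighted Cauchy-Schwarz: the sum of \<open>p i * (b i - x)\<^sup>2\<close> is a
  nonnegative quadratic in \<open>x\<close>, evaluated at its minimum \<open>A / G\<close>.\<close>

lemma infsum_square_le:
  fixes p b :: "'i \<Rightarrow> real"
  assumes p: "p summable_on S" "\<And>i. i \<in> S \<Longrightarrow> p i \<ge> 0"
    and pb: "(\<lambda>i. p i * b i) summable_on S" and pb2: "(\<lambda>i. p i * (b i)\<^sup>2) summable_on S"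
  shows "(\<Sum>\<^sub>\<infinity>i\<in>S. p i * b i)\<^sup>2 \<le> infsum p S * (\<Sum>\<^sub>\<infinity>i\<in>S. p i * (b i)\<^sup>2)"
proof -
  define A B G where "A = (\<Sum>\<^sub>\<infinity>i\<in>S. p i * b i)" and "B = (\<Sum>\<^sub>\<infinity>i\<in>S. p i * (b i)\<^sup>2)" and "G = infsum p S"
  have quad: "0 \<le> B - 2 * x * A + x\<^sup>2 * G" for x
  proof -
    have "((\<lambda>i. p i * (b i)\<^sup>2 - 2 * x * (p i * b i) + x\<^sup>2 * p i) has_sum (B - 2 * x * A + x\<^sup>2 * G)) S"
      unfolding A_def B_def G_def diff_conv_add_uminus
      by (intro has_sum_add has_sum_uminusI has_sum_cmult_right has_sum_infsum p pb pb2)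
    moreover have "p i * (b i)\<^sup>2 - 2 * x * (p i * b i) + x\<^sup>2 * p i = p i * (b i - x)\<^sup>2" for i
      by (simp add: power2_eq_square algebra_simps)
    ultimately have "((\<lambda>i. p i * (b i - x)\<^sup>2) has_sum (B - 2 * x * A + x\<^sup>2 * G)) S"
      by simp
    then show ?thesis by (rule has_sum_nonneg) (simp add: p)
  qed
  have "G \<ge> 0" unfolding G_def by (intro infsum_nonneg p)
  have "A\<^sup>2 \<le> G * B"
  proof (cases "G = 0")
    case True
    have "A = 0"
    proof (rule ccontr)
      assume "A \<noteq> 0"
      \<comment> \<open>The quadratic is affine here and takes the value -1 at this point.\<close>
      then show False using quad[of "(B + 1) / (2 * A)"] True by simp
    qed
    then show ?thesis using True by simp
  next
    case False
    have "0 \<le> G * (B - 2 * (A / G) * A + (A / G)\<^sup>2 * G)"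
      by (intro mult_nonneg_nonneg \<open>G \<ge> 0\<close> quad)
    also have "\<dots> = G * B - A\<^sup>2"
      using False by (simp add: power2_eq_square field_simps)
    finally show ?thesis by simp
  qed
  then show ?thesis by (simp add: A_def B_def G_def)
qed

lemma bij_betw_shift_int: "bij_betw (\<lambda>m::int. m + c) UNIV UNIV" "bij_betw (\<lambda>m::int. m - c) UNIV UNIV"
  "bij_betw (\<lambda>m::int. c - m) UNIV UNIV"
  by (rule bij_betwI[where g = "\<lambda>m. m - c"] bij_betwI[where g = "\<lambda>m. m + c"]
      bij_betwI[where g = "\<lambda>m. c - m"]; simp)+

lemma ell2_shift: "\<psi> \<in> ell2 \<Longrightarrow> (\<lambda>m. \<psi> (m + c)) \<in> ell2"
  unfolding ell2_def
  using summable_on_reindex_bij_betw[OF bij_betw_shift_int(1)[of c], of "\<lambda>m. (cmod (\<psi> m))\<^sup>2"] by simp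

text \<open>Fubini for nonnegative families: summing over \<open>m\<close> first gives the total
  mass of \<open>g\<close> times \<open>a l\<close>, which is summable in \<open>l\<close>.\<close>

lemma convolution_summable:
  fixes g a :: "int \<Rightarrow> real"
  assumes g: "g summable_on UNIV" "\<And>d. g d \<ge> 0" and a: "a summable_on UNIV" "\<And>l. a l \<ge> 0"
  shows "(\<lambda>l. g (m - l) * a l) summable_on UNIV"
    and "(\<lambda>m. \<Sum>\<^sub>\<infinity>l. g (m - l) * a l) summable_on UNIV"
    and "(\<Sum>\<^sub>\<infinity>m. \<Sum>\<^sub>\<infinity>l. g (m - l) * a l) = infsum g UNIV * infsum a UNIV"
proof -
  define F where "F = (\<lambda>(l, m). g (m - l) * a l)"
  have inner: "((\<lambda>m. g (m - l) * a l) has_sum (infsum g UNIV * a l)) UNIV" for l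
    using g(1) has_sum_reindex_bij_betw[OF bij_betw_shift_int(2)[of l], of g "infsum g UNIV"]
    by (intro has_sum_cmult_left) simp
  have F: "F summable_on UNIV \<times> UNIV"
  proof (rule summable_on_SigmaI)
    show "((\<lambda>m. F (l, m)) has_sum (infsum g UNIV * a l)) UNIV" for l
      unfolding F_def using inner by simp
    show "(\<lambda>l. infsum g UNIV * a l) summable_on UNIV"
      by (intro summable_on_cmult_right a)
  qed (simp add: F_def g a)
  then have F': "(\<lambda>(m, l). g (m - l) * a l) summable_on UNIV \<times> UNIV"
    using summable_on_swap[of F UNIV UNIV] by (simp add: F_def)
  show "(\<lambda>l. g (m - l) * a l) summable_on UNIV"
    using summable_on_SigmaD1[OF F'] by simp
  show "(\<lambda>m. \<Sum>\<^sub>\<infinity>l. g (m - l) * a l) summable_on UNIV"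
    by (rule summable_on_Sigma_banach[OF F'])
  have "(\<Sum>\<^sub>\<infinity>m. \<Sum>\<^sub>\<infinity>l. g (m - l) * a l) = (\<Sum>\<^sub>\<infinity>l. \<Sum>\<^sub>\<infinity>m. g (m - l) * a l)"
    by (rule infsum_swap_banach[OF F'])
  also have "\<dots> = (\<Sum>\<^sub>\<infinity>l. infsum g UNIV * a l)"
    using inner by (intro infsum_cong infsumI)
  finally show "(\<Sum>\<^sub>\<infinity>m. \<Sum>\<^sub>\<infinity>l. g (m - l) * a l) = infsum g UNIV * infsum a UNIV"
    by (simp add: infsum_cmult_right')
qed

section \<open>Kernels dominated by a summable convolution kernel\<close>

context
  fixes K :: "int \<Rightarrow> int \<Rightarrow> real" and g :: "int \<Rightarrow> real"
  assumes g_summable: "g summable_on UNIV" and K_le: "\<And>m l. \<bar>K m l\<bar> \<le> g (m - l)"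
begin

lemma dominating_nonneg: "g d \<ge> 0"
  using K_le[of d 0] by simp

lemma dominating_mult_ell2_summable:
  assumes "\<psi> \<in> ell2"
  shows "(\<lambda>l. g (m - l)) summable_on UNIV"
    and "(\<lambda>l. g (m - l) * (cmod (\<psi> l))\<^sup>2) summable_on UNIV"
    and "(\<lambda>l. g (m - l) * cmod (\<psi> l)) summable_on UNIV"
proof -
  show *: "(\<lambda>l. g (m - l)) summable_on UNIV"
    using summable_on_reindex_bij_betw[OF bij_betw_shift_int(3)[of m], of g] g_summable by simp
  show **: "(\<lambda>l. g (m - l) * (cmod (\<psi> l))\<^sup>2) summable_on UNIV"
    using assms by (intro convolution_summable g_summable dominating_nonneg) (auto simp: ell2_def)
  have "x \<le> 1 + x\<^sup>2" for x :: real
    using zero_le_power2[of "x - 1 / 2"] by (simp add: power2_eq_square algebra_simps)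
  then have "g (m - l) * cmod (\<psi> l) \<le> g (m - l) * (1 + (cmod (\<psi> l))\<^sup>2)" for l
    by (intro mult_left_mono dominating_nonneg)
  then show "(\<lambda>l. g (m - l) * cmod (\<psi> l)) summable_on UNIV"
    by (intro summable_on_comparison_test[OF summable_on_add[OF * **]])
      (simp_all add: dominating_nonneg algebra_simps)
qed

lemma kernel_abs_summable:
  assumes "\<psi> \<in> ell2"
  shows "(\<lambda>l. cmod (complex_of_real (K m l) * \<psi> l)) summable_on UNIV"
  using dominating_mult_ell2_summable(3)[OF assms, of m]
  by (rule Infinite_Sum.abs_summable_on_comparison_test') (auto simp: norm_mult intro!: mult_right_mono K_le)

lemma kernel_summable:
  "\<psi> \<in> ell2 \<Longrightarrow> (\<lambda>l. complex_of_real (K m l) * \<psi> l) summable_on UNIV"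
  by (rule Infinite_Sum.abs_summable_summable[OF kernel_abs_summable])

text \<open>Schur's test: Cauchy-Schwarz with weights \<open>g (m - l)\<close> bounds the square at
  \<open>m\<close> by \<open>G\<close> times a convolution, whose sum over \<open>m\<close> yields a
  second factor \<open>G\<close>.\<close>

lemma bounded_op_kernel: "bounded_op (\<lambda>\<psi> m. \<Sum>\<^sub>\<infinity>l. complex_of_real (K m l) * \<psi> l)"
proof -
  define G where "G = infsum g UNIV"
  have G: "G \<ge> 0" unfolding G_def by (intro infsum_nonneg dominating_nonneg)
  define T where "T = (\<lambda>\<psi> m. \<Sum>\<^sub>\<infinity>l. complex_of_real (K m l) * \<psi> l)"
  have pointwise: "(cmod (T \<psi> m))\<^sup>2 \<le> G * (\<Sum>\<^sub>\<infinity>l. g (m - l) * (cmod (\<psi> l))\<^sup>2)" if "\<psi> \<in> ell2" for \<psi> m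
  proof -
    note summ = dominating_mult_ell2_summable[OF that, of m]
    have "cmod (T \<psi> m) \<le> (\<Sum>\<^sub>\<infinity>l. cmod (complex_of_real (K m l) * \<psi> l))"
      unfolding T_def by (intro norm_infsum_bound kernel_abs_summable that)
    also have "\<dots> \<le> (\<Sum>\<^sub>\<infinity>l. g (m - l) * cmod (\<psi> l))"
      using kernel_abs_summable[OF that, of m] summ(3)
      by (rule infsum_mono) (auto simp: norm_mult intro!: mult_right_mono K_le)
    finally have "(cmod (T \<psi> m))\<^sup>2 \<le> (\<Sum>\<^sub>\<infinity>l. g (m - l) * cmod (\<psi> l))\<^sup>2"
      by (intro power_mono) auto
    also have "\<dots> \<le> (\<Sum>\<^sub>\<infinity>l. g (m - l)) * (\<Sum>\<^sub>\<infinity>l. g (m - l) * (cmod (\<psi> l))\<^sup>2)"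
      by (intro infsum_square_le summ dominating_nonneg)
    also have "(\<Sum>\<^sub>\<infinity>l. g (m - l)) = G"
      unfolding G_def by (rule infsum_reindex_bij_betw[OF bij_betw_shift_int(3)])
    finally show ?thesis .
  qed
  have T: "T \<psi> \<in> ell2 \<and> ell2_norm (T \<psi>) \<le> G * ell2_norm \<psi>" if "\<psi> \<in> ell2" for \<psi>
  proof -
    have "(\<lambda>l. (cmod (\<psi> l))\<^sup>2) summable_on UNIV" using that by (simp add: ell2_def)
    note conv = convolution_summable[OF g_summable dominating_nonneg this zero_le_power2]
    have summ: "(\<lambda>m. G * (\<Sum>\<^sub>\<infinity>l. g (m - l) * (cmod (\<psi> l))\<^sup>2)) summable_on UNIV"
      by (intro summable_on_cmult_right conv)
    have "(\<lambda>m. (cmod (T \<psi> m))\<^sup>2) summable_on UNIV"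
      by (rule summable_on_comparison_test[OF summ]) (simp_all add: pointwise that)
    moreover from this have "(\<Sum>\<^sub>\<infinity>m. (cmod (T \<psi> m))\<^sup>2) \<le> G\<^sup>2 * (\<Sum>\<^sub>\<infinity>l. (cmod (\<psi> l))\<^sup>2)"
      using infsum_mono[OF _ summ pointwise[OF that]] conv(3)
      by (simp add: infsum_cmult_right' G_def power2_eq_square mult.assoc)
    then have "sqrt (\<Sum>\<^sub>\<infinity>m. (cmod (T \<psi> m))\<^sup>2) \<le> G * sqrt (\<Sum>\<^sub>\<infinity>l. (cmod (\<psi> l))\<^sup>2)"
      using G real_sqrt_le_mono by (fastforce simp: real_sqrt_mult)
    ultimately show ?thesis by (simp add: ell2_def ell2_norm_def)
  qed
  have "T (\<lambda>m. \<phi> m + \<psi> m) = (\<lambda>m. T \<phi> m + T \<psi> m)" if "\<phi> \<in> ell2" "\<psi> \<in> ell2" for \<phi> \<psi>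
    unfolding T_def using that by (simp add: distrib_left infsum_add kernel_summable)
  moreover have "T (\<lambda>m. c * \<psi> m) = (\<lambda>m. c * T \<psi> m)" for c \<psi>
    unfolding T_def by (simp add: infsum_cmult_right' mult.left_commute)
  ultimately have "bounded_op T" unfolding bounded_op_def using T by blast
  then show ?thesis by (simp add: T_def)
qed

text \<open>\<open>green\<close> makes the kernel a right inverse of H - E. For the left inverse,
  shifting the summation index moves the operator to the second argument of \<open>K\<close>, where
  \<open>sym\<close> gives the same equation.\<close>

lemma notin_ell2_spec_of_green_kernel:
  fixes V :: "int \<Rightarrow> real"
  assumes sym: "\<And>m l. K m l = K l m"
    and green: "\<And>m l. K (m - 1) l + K (m + 1) l + (V m - E) * K m l = of_bool (m = l)"
  shows "complex_of_real E \<notin> ell2_spec (\<lambda>\<psi> m. \<psi> (m - 1) + \<psi> (m + 1) + complex_of_real (V m) * \<psi> m)"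
proof -
  define R where "R = (\<lambda>\<psi> m. \<Sum>\<^sub>\<infinity>l. complex_of_real (K m l) * \<psi> l)"
  have R: "((\<lambda>l. complex_of_real (K m l) * \<psi> l) has_sum R \<psi> m) UNIV" if "\<psi> \<in> ell2" for \<psi> m
    unfolding R_def using that by (intro has_sum_infsum kernel_summable)
  have delta: "((\<lambda>l. of_bool (m = l) * \<psi> l) has_sum \<psi> m) UNIV" for m and \<psi> :: "int \<Rightarrow> complex"
    by (rule has_sum_finite_neutralI[of "{m}"]) auto
  have left: "R (\<lambda>m. \<psi> (m - 1) + \<psi> (m + 1) + complex_of_real (V m) * \<psi> m - complex_of_real E * \<psi> m) = \<psi>"
    if "\<psi> \<in> ell2" for \<psi>
  proof
    fix m
    have "(\<lambda>m. \<psi> (m + -1)) \<in> ell2" using that by (rule ell2_shift)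
    then have minus: "(\<lambda>m. \<psi> (m - 1)) \<in> ell2" by simp
    have plus: "(\<lambda>m. \<psi> (m + 1)) \<in> ell2" using that by (rule ell2_shift)
    define s1 s2 where "s1 = R (\<lambda>m. \<psi> (m - 1)) m" and "s2 = R (\<lambda>m. \<psi> (m + 1)) m"
    have h1: "((\<lambda>l. complex_of_real (K m l) * \<psi> (l - 1)) has_sum s1) UNIV"
      and h2: "((\<lambda>l. complex_of_real (K m l) * \<psi> (l + 1)) has_sum s2) UNIV"
      unfolding s1_def s2_def using R[OF minus] R[OF plus] by auto
    have h1': "((\<lambda>l. complex_of_real (K m (l + 1)) * \<psi> l) has_sum s1) UNIV"
      using has_sum_reindex_bij_betw[OF bij_betw_shift_int(1)[of 1], of "\<lambda>l. complex_of_real (K m l) * \<psi> (l - 1)" s1] h1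
      by simp
    have h2': "((\<lambda>l. complex_of_real (K m (l - 1)) * \<psi> l) has_sum s2) UNIV"
      using has_sum_reindex_bij_betw[OF bij_betw_shift_int(2)[of 1], of "\<lambda>l. complex_of_real (K m l) * \<psi> (l + 1)" s2] h2
      by simp
    have delta_eq: "of_bool (m = l) = complex_of_real (K m (l - 1)) + complex_of_real (K m (l + 1))
        + (complex_of_real (V l) - complex_of_real E) * complex_of_real (K m l)" for l
      using arg_cong[OF green[of l m], of complex_of_real]
      unfolding sym[of "l - 1" m] sym[of "l + 1" m] sym[of l m] eq_commute[of l m]
      by simp
    \<comment> \<open>The potential term is traded for the delta through \<open>delta_eq\<close>;
      the shifted kernels then cancel the first two sums and only the value of \<psi> at
      \<open>m\<close> remains.\<close>
    have "complex_of_real (K m l) * (\<psi> (l - 1) + \<psi> (l + 1) + complex_of_real (V l) * \<psi> l - complex_of_real E * \<psi> l)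
        = complex_of_real (K m l) * \<psi> (l - 1) + complex_of_real (K m l) * \<psi> (l + 1)
          + (of_bool (m = l) * \<psi> l - complex_of_real (K m (l + 1)) * \<psi> l - complex_of_real (K m (l - 1)) * \<psi> l)" for l
      unfolding delta_eq by (simp add: algebra_simps)
    moreover have "((\<lambda>l. complex_of_real (K m l) * \<psi> (l - 1) + complex_of_real (K m l) * \<psi> (l + 1)
          + (of_bool (m = l) * \<psi> l - complex_of_real (K m (l + 1)) * \<psi> l - complex_of_real (K m (l - 1)) * \<psi> l))
        has_sum (s1 + s2 + (\<psi> m - s1 - s2))) UNIV"
      unfolding diff_conv_add_uminus
      by (intro has_sum_add has_sum_uminusI h1 h2) (use delta h1 h2 h1' h2' in auto)
    ultimately show "R (\<lambda>m. \<psi> (m - 1) + \<psi> (m + 1) + complex_of_real (V m) * \<psi> m - complex_of_real E * \<psi> m) m = \<psi> m"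
      unfolding R_def by (simp add: infsumI)
  qed
  have right: "(\<lambda>m. R \<psi> (m - 1) + R \<psi> (m + 1) + complex_of_real (V m) * R \<psi> m - complex_of_real E * R \<psi> m) = \<psi>"
    if "\<psi> \<in> ell2" for \<psi>
  proof
    fix m
    have "((\<lambda>l. complex_of_real (K (m - 1) l) * \<psi> l + complex_of_real (K (m + 1) l) * \<psi> l
          + complex_of_real (V m - E) * (complex_of_real (K m l) * \<psi> l))
        has_sum (R \<psi> (m - 1) + R \<psi> (m + 1) + complex_of_real (V m - E) * R \<psi> m)) UNIV"
      by (intro has_sum_add has_sum_cmult_right R that)
    moreover have "complex_of_real (K (m - 1) l) * \<psi> l + complex_of_real (K (m + 1) l) * \<psi> l
          + complex_of_real (V m - E) * (complex_of_real (K m l) * \<psi> l) = of_bool (m = l) * \<psi> l" for l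
      using arg_cong[OF green[of m l], of "\<lambda>x. complex_of_real x * \<psi> l"]
      by (simp add: algebra_simps)
    ultimately show "R \<psi> (m - 1) + R \<psi> (m + 1) + complex_of_real (V m) * R \<psi> m - complex_of_real E * R \<psi> m = \<psi> m"
      using has_sum_unique[OF _ delta[of m \<psi>]] by (simp add: algebra_simps)
  qed
  have "bounded_op R" unfolding R_def by (rule bounded_op_kernel)
  then show ?thesis unfolding ell2_spec_def using left right by auto
qed

end

lemma summable_on_geometric_int:
  fixes r :: real
  assumes "0 \<le> r" "r < 1"
  shows "(\<lambda>d::int. r ^ nat \<bar>d\<bar>) summable_on UNIV"
proof -
  have geo: "(\<lambda>i. r ^ i) summable_on (UNIV :: nat set)"
    using assms by (intro summable_nonneg_imp_summable_on summable_geometric) auto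
  have "(\<lambda>d. r ^ nat \<bar>d\<bar>) summable_on range int" "(\<lambda>d. r ^ nat \<bar>d\<bar>) summable_on range (\<lambda>i. - int i)"
    using geo by (simp_all add: summable_on_reindex inj_on_def o_def)
  then have "(\<lambda>d::int. r ^ nat \<bar>d\<bar>) summable_on (range int \<union> range (\<lambda>i. - int i))"
    by (rule summable_on_union)
  moreover have "range int \<union> range (\<lambda>i. - int i) = UNIV"
    by (auto simp: image_iff) (metis int_cases2)
  ultimately show ?thesis by simp
qed

section \<open>Hyperbolic energies of periodic potentials\<close>

lemma eigenvector_exists_mat2:
  fixes M :: "real^2^2"
  assumes "det M = 1" "\<mu>\<^sup>2 - trace M * \<mu> + 1 = 0"
  obtains v where "v \<noteq> 0" "M *v v = \<mu> *s v"
proof -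
  have "det (M - mat \<mu>) = 0"
    using assms unfolding det_2 trace_mat2 by (simp add: mat_def) algebra
  then have "\<not> (\<exists>B. B ** (M - mat \<mu>) = mat 1)"
    by (metis invertible_det_nz invertible_left_inverse)
  then obtain v where v: "v \<noteq> 0" "(M - mat \<mu>) *v v = 0"
    unfolding matrix_left_invertible_ker by blast
  have "M *v v = \<mu> *s v"
    using v(2) by (simp add: vec_eq_iff forall_2 matrix_vector_mult_def sum_2 mat_def algebra_simps)
  with v(1) that show thesis by blast
qed

text \<open>The determinant will be the Wronskian of the two Floquet solutions, by which the Green's
  function is divided.\<close>

lemma eigenvectors_independent_mat2:
  fixes M :: "real^2^2"
  assumes v: "v \<noteq> 0" "M *v v = \<mu> *s v" and w: "w \<noteq> 0" "M *v w = \<nu> *s w" and "\<mu> \<noteq> \<nu>"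
  shows "v$1 * w$2 - v$2 * w$1 \<noteq> 0"
proof
  assume 0: "v$1 * w$2 - v$2 * w$1 = 0"
  have "M$1$1 * v$1 + M$1$2 * v$2 = \<mu> * v$1" "M$2$1 * v$1 + M$2$2 * v$2 = \<mu> * v$2"
    "M$1$1 * w$1 + M$1$2 * w$2 = \<nu> * w$1" "M$2$1 * w$1 + M$2$2 * w$2 = \<nu> * w$2"
    using v(2) w(2) by (simp_all add: vec_eq_iff forall_2 matrix_vector_mult_def sum_2)
  then have "(\<mu> - \<nu>) * (v$1 * w$1) = 0" "(\<mu> - \<nu>) * (v$2 * w$2) = 0"
    using 0 by algebra+
  then have "v$1 * w$1 = 0" "v$2 * w$2 = 0" using \<open>\<mu> \<noteq> \<nu>\<close> by auto
  then show False using 0 v(1) w(1) by (auto simp: vec_eq_iff forall_2)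
qed

text \<open>The discriminant \<open>x\<^sup>2 - 4\<close> is positive, so the characteristic roots
  are real; two mutually inverse roots of modulus 1 could not add up to \<open>x\<close>. The
  contracting root comes first.\<close>

lemma hyperbolic_eigenvalues:
  fixes x :: real
  assumes "\<bar>x\<bar> > 2"
  obtains \<mu> \<nu> where "\<mu> * \<nu> = 1" "\<mu> + \<nu> = x" "\<bar>\<mu>\<bar> < 1"
proof -
  define d where "d = sqrt (x\<^sup>2 - 4)"
  have "x\<^sup>2 > 2\<^sup>2" using assms by (metis abs_numeral abs_le_square_iff not_le)
  then have d: "d\<^sup>2 = x\<^sup>2 - 4" "d > 0" by (simp_all add: d_def)
  define \<alpha> \<beta> where "\<alpha> = (x + d) / 2" and "\<beta> = (x - d) / 2"
  have ab: "\<alpha> * \<beta> = 1" "\<alpha> + \<beta> = x" "\<alpha> \<noteq> \<beta>"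
    using d by (simp_all add: \<alpha>_def \<beta>_def field_simps power2_eq_square)
  then have p: "\<bar>\<alpha>\<bar> * \<bar>\<beta>\<bar> = 1" by (metis abs_mult abs_one)
  show thesis
  proof (cases "\<bar>\<alpha>\<bar> < 1")
    case True
    then show thesis using that ab by blast
  next
    case False
    have "\<bar>\<beta>\<bar> < 1"
    proof (rule ccontr)
      assume "\<not> \<bar>\<beta>\<bar> < 1"
      with False p have "\<bar>\<alpha>\<bar> = 1" "\<bar>\<beta>\<bar> = 1"
        by (smt (verit) mult_le_cancel_left1 mult_le_cancel_right1)+
      then show False using ab assms by (auto simp: abs_if split: if_splits)
    qed
    then show thesis using that[of \<beta> \<alpha>] ab by (simp add: algebra_simps)
  qed
qed

text \<open>\<open>r\<close> spreads the factor of a whole period evenly over its sites; the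
  constant then only has to absorb the values on one period.\<close>

lemma floquet_bound:
  fixes u :: "int \<Rightarrow> real"
  assumes u: "\<And>m. u m = \<mu> powi ((m - a) div int N) * u (a + (m - a) mod int N)"
    and N: "N > 0" and r: "r > 0" "r ^ N = \<bar>\<mu>\<bar>"
  obtains C where "\<And>m. \<bar>u m\<bar> \<le> C * r powi m"
proof
  \<comment> \<open>Size of \<open>u\<close> at site \<open>a + j\<close> relative to
    \<open>r powi (a + j)\<close>.\<close>
  define h where "h = (\<lambda>j. r powi (- a - j) * \<bar>u (a + j)\<bar>)"
  fix m
  define q j where "q = (m - a) div int N" and "j = (m - a) mod int N"
  have m: "m = a + j + int N * q" unfolding q_def j_def by simp
  have "\<bar>\<mu>\<bar> powi q = r powi (int N * q)"
    by (simp add: power_int_mult flip: r(2))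
  also have "\<dots> = r powi (m + (- a - j))" by (simp add: m)
  also have "\<dots> = r powi m * r powi (- a - j)" using r(1) by (intro power_int_add) simp
  finally have "\<bar>u m\<bar> = h j * r powi m"
    by (subst u) (simp add: abs_mult power_int_abs h_def flip: q_def j_def)
  also have "h j \<le> (\<Sum>j\<in>{0..<int N}. h j)"
    using N r(1) by (intro member_le_sum) (auto simp: j_def h_def)
  finally show "\<bar>u m\<bar> \<le> (\<Sum>j\<in>{0..<int N}. h j) * r powi m"
    using r(1) by simp
qed

text \<open>The Floquet solution of the contracting \<mu> decays to the right, that of its inverse
  to the left; together they form a Green's function. As \<open>a\<close> is free, the trace may be
  computed over any window of one period.\<close>

lemma hyperbolic_notin_ell2_spec:
  fixes V :: "int \<Rightarrow> real"
  assumes per: "\<And>m. V (m + int N) = V m" and N: "N > 0"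
    and hyp: "\<bar>trace (transfer (\<lambda>i. E - V (a + 1 + int i)) N)\<bar> > 2"
  shows "complex_of_real E \<notin> ell2_spec (\<lambda>\<psi> m. \<psi> (m - 1) + \<psi> (m + 1) + complex_of_real (V m) * \<psi> m)"
proof -
  define M where "M = transfer (\<lambda>i. E - V (a + 1 + int i)) N"
  have det: "det M = 1" unfolding M_def by (rule det_transfer)
  obtain \<mu> \<nu> where ev: "\<mu> * \<nu> = 1" "\<mu> + \<nu> = trace M" "\<bar>\<mu>\<bar> < 1"
    using hyperbolic_eigenvalues[OF hyp] unfolding M_def by blast
  have ne: "\<mu> \<noteq> \<nu>" "\<mu> \<noteq> 0" "\<nu> \<noteq> 0"
    using ev abs_square_less_1[of \<mu>] by (auto simp: power2_eq_square)
  have "\<mu>\<^sup>2 - trace M * \<mu> + 1 = 0" "\<nu>\<^sup>2 - trace M * \<nu> + 1 = 0"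
    using ev by algebra+
  then obtain v w where v: "v \<noteq> 0" "M *v v = \<mu> *s v" and w: "w \<noteq> 0" "M *v w = \<nu> *s w"
    using eigenvector_exists_mat2[OF det] by metis
  have evM: "transfer (\<lambda>i. E - V (a + 1 + int i)) N *v v = \<mu> *s v"
    "transfer (\<lambda>i. E - V (a + 1 + int i)) N *v w = \<nu> *s w"
    using v(2) w(2) unfolding M_def .
  have perE: "E - V (m + int N) = E - V m" for m by (simp add: per)
  obtain u where u: "\<And>m. u (m - 1) + u (m + 1) = (E - V m) * u m"
      "\<And>m. u m = \<mu> powi ((m - a) div int N) * u (a + (m - a) mod int N)" "vector [u (a + 1), u a] = v"
    by (rule floquet_solution[where t = "\<lambda>m. E - V m", OF perE N evM(1) ne(2)]) (rule that)
  obtain u' where u': "\<And>m. u' (m - 1) + u' (m + 1) = (E - V m) * u' m"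
      "\<And>m. u' m = \<nu> powi ((m - a) div int N) * u' (a + (m - a) mod int N)" "vector [u' (a + 1), u' a] = w"
    by (rule floquet_solution[where t = "\<lambda>m. E - V m", OF perE N evM(2) ne(3)]) (rule that)
  define r where "r = root N \<bar>\<mu>\<bar>"
  have r: "0 < r" "r < 1" "r ^ N = \<bar>\<mu>\<bar>"
    using N ne ev(3) by (simp_all add: r_def)
  have r': "inverse r > 0" "inverse r ^ N = \<bar>\<nu>\<bar>"
    using r ev(1) ne by (simp_all add: power_inverse field_simps flip: abs_mult)
  obtain C where C: "\<And>m. \<bar>u m\<bar> \<le> C * r powi m"
    using floquet_bound[OF u(2) N r(1,3)] by blast
  obtain C' where C': "\<And>m. \<bar>u' m\<bar> \<le> C' * inverse r powi m"
    using floquet_bound[OF u'(2) N r'] by blast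
  define W where "W m = u (m + 1) * u' m - u m * u' (m + 1)" for m
  have W_step: "W m = W (m - 1)" for m
    using u(1)[of m] u'(1)[of m] unfolding W_def by simp algebra
  have W_const: "W m = W a" for m
  proof (induction m rule: int_induct[where k = a])
    case (step1 i) then show ?case using W_step[of "i + 1"] by simp
  next
    case (step2 i) then show ?case using W_step[of i] by simp
  qed simp
  have "W a = v$1 * w$2 - v$2 * w$1"
    unfolding W_def u(3)[symmetric] u'(3)[symmetric] by (simp only: vector_2)
  then have W: "W a \<noteq> 0" using eigenvectors_independent_mat2[OF v w ne(1)] by simp
  \<comment> \<open>The smaller index goes with the solution decaying to the left, the larger one
    with that decaying to the right, so the two bounds combine to \<open>r\<close> raised to the
    distance.\<close>
  define K where "K m l = u' (min m l) * u (max m l) / W a" for m l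
  define B where "B = C' * C / \<bar>W a\<bar>"
  show ?thesis
  proof (rule notin_ell2_spec_of_green_kernel)
    show "(\<lambda>d. B * r ^ nat \<bar>d\<bar>) summable_on UNIV"
      using r by (intro summable_on_cmult_right summable_on_geometric_int) auto
  next
    fix m l
    have "\<bar>K m l\<bar> \<le> (C' * inverse r powi min m l) * (C * r powi max m l) / \<bar>W a\<bar>"
      unfolding K_def abs_mult abs_divide
      by (intro divide_right_mono mult_mono C C' order_trans[OF abs_ge_zero C']) auto
    also have "\<dots> = B * (r powi (max m l) * r powi (- min m l))"
      by (simp add: B_def power_int_minus power_int_inverse)
    also have "r powi (max m l) * r powi (- min m l) = r powi (max m l + - min m l)"
      using r(1) by (intro power_int_add[symmetric]) simp
    also have "max m l + - min m l = int (nat \<bar>m - l\<bar>)" by (simp add: max_def min_def)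
    finally show "\<bar>K m l\<bar> \<le> B * r ^ nat \<bar>m - l\<bar>" by (simp only: power_int_of_nat)
  next
    show "K m l = K l m" for m l by (simp add: K_def min.commute max.commute)
  next
    fix m l :: int
    \<comment> \<open>Off the diagonal only one of the two solutions moves with \<open>m\<close>,
      and its equation gives 0; on the diagonal the Wronskian is left.\<close>
    consider "m < l" | "m = l" | "m > l" by linarith
    then have "W a * (K (m - 1) l + K (m + 1) l + (V m - E) * K m l) = W a * of_bool (m = l)"
    proof cases
      case 1
      then have "min (m - 1) l = m - 1" "max (m - 1) l = l" "min (m + 1) l = m + 1" "max (m + 1) l = l"
        "min m l = m" "max m l = l" by auto
      then have "W a * (K (m - 1) l + K (m + 1) l + (V m - E) * K m l)
          = (u' (m - 1) + u' (m + 1) - (E - V m) * u' m) * u l"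
        using W by (simp add: K_def field_simps)
      then show ?thesis using 1 u'(1)[of m] by simp
    next
      case 2
      then have "W a * (K (m - 1) l + K (m + 1) l + (V m - E) * K m l)
          = (u' (m - 1) - (E - V m) * u' m) * u m + u' m * u (m + 1)"
        using W by (simp add: K_def field_simps)
      also have "\<dots> = W m"
        unfolding W_def u'(1)[of m, symmetric] by (simp add: algebra_simps)
      finally show ?thesis using 2 W_const[of m] by simp
    next
      case 3
      then have "min (m - 1) l = l" "max (m - 1) l = m - 1" "min (m + 1) l = l" "max (m + 1) l = m + 1"
        "min m l = l" "max m l = m" by auto
      then have "W a * (K (m - 1) l + K (m + 1) l + (V m - E) * K m l)
          = (u (m - 1) + u (m + 1) - (E - V m) * u m) * u' l"
        using W by (simp add: K_def field_simps)
      then show ?thesis using 3 u(1)[of m] by simp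
    qed
    then show "K (m - 1) l + K (m + 1) l + (V m - E) * K m l = of_bool (m = l)"
      using W by simp
  qed
qed

section \<open>Constant blocks\<close>

lemma transfer_periodic_mult:
  assumes "\<And>i. f (i + N) = f i"
  shows "transfer f (k * N) ** B = ((**) (transfer f N) ^^ k) B"
proof (induction k)
  case (Suc k)
  have "f (k * N + l) = f l" for l
  proof (induction k)
    case (Suc k)
    then show ?case using assms[of "k * N + l"] by (simp add: ac_simps)
  qed simp
  then have "transfer f (Suc k * N) = transfer f N ** transfer f (k * N)"
    using transfer_add[of f "k * N" N] by (simp add: add.commute)
  then show ?case using Suc by (simp flip: matrix_mul_assoc)
qed simp

section \<open>Norm and topology of constant vectors\<close>

lemma const_vec_in_Euclidean_space: "const_vec n x \<in> topspace (Euclidean_space n)"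
  by (simp add: topspace_Euclidean_space const_vec_def)

lemma is_norm_diff_const_vec:
  assumes "is_norm n \<nu>"
  shows "\<nu> (\<lambda>i. const_vec n x i - const_vec n y i) = \<bar>x - y\<bar> * \<nu> (const_vec n 1)"
proof -
  have "(\<lambda>i. const_vec n x i - const_vec n y i) = (\<lambda>i. (x - y) * const_vec n 1 i)"
    by (auto simp: const_vec_def)
  moreover have "\<forall>c. \<forall>v\<in>topspace (Euclidean_space n). \<nu> (\<lambda>i. c * v i) = \<bar>c\<bar> * \<nu> v"
    using assms unfolding is_norm_def by blast
  ultimately show ?thesis using const_vec_in_Euclidean_space[of n 1] by metis
qed

lemma closedin_range_const_vec:
  assumes "n \<ge> 1"
  shows "closedin (Euclidean_space n) (range (const_vec n))"
proof -
  \<comment> \<open>Equations between coordinates cut out a closed set of the product topology;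
    \<open>n \<ge> 1\<close> makes coordinate 0 carry the common value.\<close>
  have "range (const_vec n) = {f. \<forall>i. f i = (if i < n then f 0 else 0)}"
  proof (intro subset_antisym subsetI)
    fix v assume "v \<in> {f. \<forall>i. f i = (if i < n then f 0 else (0 :: real))}"
    then have "v = const_vec n (v 0)" unfolding const_vec_def by blast
    then show "v \<in> range (const_vec n)" by blast
  qed (use assms in \<open>auto simp: const_vec_def\<close>)
  moreover have "continuous_on UNIV (\<lambda>f. if i < n then f 0 else 0 :: real)" for i
    by (cases "i < n") (simp_all add: continuous_on_product_coordinates)
  then have "closed {f. \<forall>i. f i = (if i < n then f 0 else (0 :: real))}"
    by (intro closed_Collect_all closed_Collect_eq continuous_on_product_coordinates)
  ultimately show ?thesis
    unfolding closedin_Euclidean_space_iff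
    by (metis const_vec_in_Euclidean_space image_subsetI)
qed

lemma range_const_vec_subset_derived_set:
  assumes "n \<ge> 1"
  shows "range (const_vec n) \<subseteq> Euclidean_space n derived_set_of range (const_vec n)"
proof
  fix v assume "v \<in> range (const_vec n)"
  then obtain x where v: "v = const_vec n x" by blast
  have cont: "continuous_map euclideanreal (Euclidean_space n) (const_vec n)"
    using continuous_map_componentwise_Euclidean_space[of euclideanreal n "\<lambda>x i. x"]
    by (simp add: const_vec_def[abs_def])
  have "\<exists>w. w \<noteq> v \<and> w \<in> range (const_vec n) \<and> w \<in> T"
    if T: "v \<in> T" "openin (Euclidean_space n) T" for T
  proof -
    have "open {c. const_vec n c \<in> T}"
      using openin_continuous_map_preimage[OF cont T(2)] by simp
    moreover have "x \<in> {c. const_vec n c \<in> T}" using T(1) v by simp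
    ultimately obtain e where e: "e > 0" "ball x e \<subseteq> {c. const_vec n c \<in> T}"
      by (meson open_contains_ball)
    have "x + e / 2 \<in> ball x e" using e(1) by (simp add: dist_real_def)
    then have "const_vec n (x + e / 2) \<in> T" using e(2) by blast
    moreover have "const_vec n (x + e / 2) 0 \<noteq> v 0" using e(1) assms v by (simp add: const_vec_def)
    ultimately show ?thesis by (metis rangeI)
  qed
  then show "v \<in> Euclidean_space n derived_set_of range (const_vec n)"
    unfolding in_derived_set_of using const_vec_in_Euclidean_space[of n x] v by blast
qed

section \<open>Potentials of periodic words\<close>

lemma flatten_periodize_periodic:
  assumes "k > 0"
  shows "flatten k (periodize y) (m + int (k * length y)) = flatten k (periodize y) m"
proof -
  have "m + int (k * length y) - 1 = (m - 1) + int k * int (length y)" by simp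
  then show ?thesis
    unfolding flatten_def using assms periodize_periodic[of y "(m - 1) div int k"]
    by (simp only: div_mult_self2 mod_mult_self2) (simp add: add.commute)
qed

text \<open>Block \<open>0\<close> of the potential carries the last letter of the word, so the letters
  are met in their order from site \<open>k + 1\<close> on.\<close>

lemma flatten_periodize_letter:
  assumes "k > 0" "i < k * length y"
  shows "flatten k (periodize y) (int k + 1 + int i) = (y ! (i div k)) (i mod k)"
proof -
  have "i div k < length y" using assms by (simp add: less_mult_imp_div_less mult.commute)
  moreover have "(int k + 1 + int i - 1) div int k = int (i div k + 1)"
    "(int k + 1 + int i - 1) mod int k = int (i mod k)"
    using assms(1) by (simp_all add: zdiv_int zmod_int)
  ultimately show ?thesis
    unfolding flatten_def using periodize_eq_nth[of "i div k + 1" y] by simp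
qed

text \<open>The approximating word repeats \<open>x\<close> \<open>k + 1\<close> times, with the
  letters of the first copy lowered by \<open>s'\<close> and those of the others by
  \<open>s\<close>. Lowering all coordinates equally keeps each letter a constant vector.\<close>

lemma gap_rich_with_range_const_vec:
  assumes n: "n \<ge> 1" and \<nu>: "is_norm n \<nu>"
  shows "gap_rich_with n \<nu> (range (const_vec n)) {}"
proof -
  have "\<exists>y\<in>words (range (const_vec n)). word_dist \<nu> x y < \<epsilon> \<and>
      complex_of_real E \<notin> ell2_spec (schroedinger n (periodize y))"
    if x: "x \<in> words (range (const_vec n))" and \<epsilon>: "\<epsilon> > 0" for E x \<epsilon>
  proof -
    define p where "p = length x"
    define c where "c q = (x ! q) 0" for q
    have p: "p > 0" using x by (simp add: words_def p_def)
    have x_nth: "x ! q = const_vec n (c q)" if "q < p" for q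
    proof -
      have "x ! q \<in> range (const_vec n)" using x that by (auto simp: words_def p_def)
      then show ?thesis using n by (auto simp: c_def const_vec_def)
    qed
    \<comment> \<open>Energy minus potential for the unperturbed word, each letter spread over
      \<open>n\<close> sites; lowering the letters by \<open>s\<close> raises \<open>f\<close> by
      \<open>s\<close>.\<close>
    define f where "f i = E - c (i div n mod p)" for i
    define N where "N = n * p"
    have N: "N > 0" using n p by (simp add: N_def)
    have f_per: "f (i + N) = f i" for i using n by (simp add: f_def N_def)
    define \<nu>1 where "\<nu>1 = \<nu> (const_vec n 1)"
    have \<nu>1: "\<nu>1 \<ge> 0"
      using \<nu> const_vec_in_Euclidean_space[of n 1] unfolding is_norm_def \<nu>1_def by blast
    have "\<epsilon> / (\<nu>1 + 1) > 0" using \<epsilon> \<nu>1 by simp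
    then obtain s s' k where s: "\<bar>s\<bar> < \<epsilon> / (\<nu>1 + 1)" "\<bar>s'\<bar> < \<epsilon> / (\<nu>1 + 1)"
      and hyp: "\<bar>trace (((**) (transfer (\<lambda>l. f l + s) N) ^^ k) (transfer (\<lambda>l. f l + s') N))\<bar> > 2"
      using exists_hyperbolic_shift[OF N] by metis
    define \<sigma> where "\<sigma> q = (if q < p then s' else s)" for q
    define y where "y = map (\<lambda>q. const_vec n (c (q mod p) - \<sigma> q)) [0..<(k + 1) * p]"
    have len: "length y = (k + 1) * p" by (simp add: y_def)
    have y_nth: "y ! q = const_vec n (c (q mod p) - \<sigma> q)" if "q < (k + 1) * p" for q
      using that by (simp add: y_def)
    have y: "y \<in> words (range (const_vec n))"
      using p by (auto simp: words_def y_def)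
    have "word_dist \<nu> x y \<le> max \<bar>s\<bar> \<bar>s'\<bar> * \<nu>1"
      unfolding word_dist_def
    proof (rule cSUP_least)
      fix j :: int
      define q where "q = nat ((j - 1) mod int (length y))"
      have "0 < int (length y)" using p len by (simp only: of_nat_0_less_iff) simp
      then have int_q: "int q = (j - 1) mod int (length y)" "(j - 1) mod int (length y) < int (length y)"
        unfolding q_def by simp_all
      then have q: "q < (k + 1) * p" unfolding len by linarith
      \<comment> \<open>The two periods differ, but that of \<open>x\<close> divides that of
        \<open>y\<close>, so the position \<open>q\<close> in \<open>y\<close> determines both
        letters.\<close>
      have "int p dvd int (length y)" unfolding len by simp
      then have "int q mod int p = (j - 1) mod int p"
        unfolding int_q by (rule mod_mod_cancel)
      then have "nat ((j - 1) mod int (length x)) = q mod p"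
        unfolding p_def[symmetric] by (metis nat_int of_nat_mod)
      then have "periodize x j = const_vec n (c (q mod p))"
        unfolding periodize_def using x_nth p by simp
      moreover have "periodize y j = const_vec n (c (q mod p) - \<sigma> q)"
        unfolding periodize_def q_def[symmetric] using q by (rule y_nth)
      ultimately have "\<nu> (\<lambda>i. periodize x j i - periodize y j i) = \<bar>\<sigma> q\<bar> * \<nu>1"
        using is_norm_diff_const_vec[OF \<nu>] by (simp add: \<nu>1_def)
      also have "\<dots> \<le> max \<bar>s\<bar> \<bar>s'\<bar> * \<nu>1"
        using \<nu>1 by (intro mult_right_mono) (auto simp: \<sigma>_def)
      finally show "\<nu> (\<lambda>i. periodize x j i - periodize y j i) \<le> max \<bar>s\<bar> \<bar>s'\<bar> * \<nu>1" .
    qed simp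
    also have "\<dots> \<le> max \<bar>s\<bar> \<bar>s'\<bar> * (\<nu>1 + 1)" by (intro mult_left_mono) auto
    also have "\<dots> < \<epsilon>"
      using s \<nu>1 by (simp add: pos_less_divide_eq[symmetric])
    finally have dist: "word_dist \<nu> x y < \<epsilon>" .
    define V where "V = flatten n (periodize y)"
    \<comment> \<open>Sites are counted from \<open>n + 1\<close>, the first site of the first
      letter of \<open>y\<close>.\<close>
    define h where "h i = E - V (int n + 1 + int i)" for i
    have Nk: "n * length y = N + k * N" by (simp add: len N_def algebra_simps)
    have h: "h i = f i + \<sigma> (i div n)" if "i < N + k * N" for i
    proof -
      have "i div n < (k + 1) * p"
        using that n unfolding Nk[symmetric] len by (simp add: less_mult_imp_div_less mult.commute)
      then show ?thesis
        using flatten_periodize_letter[of n i y] that n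
        by (simp add: h_def V_def f_def Nk y_nth const_vec_def)
    qed
    \<comment> \<open>The first \<open>N\<close> sites form the copy shifted by \<open>s'\<close>,
      the remaining \<open>k * N\<close> the copies shifted by \<open>s\<close>.\<close>
    have "transfer h N = transfer (\<lambda>l. f l + s') N"
      using h by (intro transfer_cong) (auto simp: \<sigma>_def N_def less_mult_imp_div_less mult.commute)
    moreover have "transfer (\<lambda>l. h (N + l)) (k * N) = transfer (\<lambda>l. f l + s) (k * N)"
    proof (rule transfer_cong)
      fix l assume "l < k * N"
      moreover have "(N + l) div n \<ge> p" using n by (simp add: N_def)
      ultimately show "h (N + l) = f l + s"
        using h[of "N + l"] f_per[of l] by (simp add: \<sigma>_def add.commute)
    qed
    ultimately have "transfer h (N + k * N) = ((**) (transfer (\<lambda>l. f l + s) N) ^^ k) (transfer (\<lambda>l. f l + s') N)"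
      using transfer_periodic_mult[of "\<lambda>l. f l + s" N k] f_per by (simp add: transfer_add)
    then have hyp': "\<bar>trace (transfer (\<lambda>i. E - V (int n + 1 + int i)) (n * length y))\<bar> > 2"
      using hyp unfolding Nk h_def[symmetric] by simp
    have "V (m + int (n * length y)) = V m" for m
      unfolding V_def using n by (intro flatten_periodize_periodic) simp
    moreover have "n * length y > 0" unfolding Nk using N by simp
    ultimately have "complex_of_real E \<notin> ell2_spec (schroedinger n (periodize y))"
      using hyperbolic_notin_ell2_spec[OF _ _ hyp'] unfolding schroedinger_def[abs_def] V_def by blast
    then show ?thesis using y dist by blast
  qed
  then show ?thesis
    unfolding gap_rich_with_def
    using n closedin_range_const_vec range_const_vec_subset_derived_set by (auto simp: discrete_def)
qed

theorem theorem2p12: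
  fixes n :: nat and \<nu> :: "(nat \<Rightarrow> real) \<Rightarrow> real"
  assumes "n \<ge> 1"
    and "is_norm n \<nu>"
  shows "gap_rich n \<nu> {const_vec n x | x. x \<in> (UNIV :: real set)}"
proof -
  have "{const_vec n x | x. x \<in> (UNIV :: real set)} = range (const_vec n)" by auto
  then show ?thesis using gap_rich_with_range_const_vec[OF assms] unfolding gap_rich_def by auto
qed

end
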